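(* If $n$ is a Deaconescu number, then the number of distinct prime divisors of $n$ is at least seventeen, that is, $\omega(n) \geq 17$.
   Context: $\phi$ denotes Euler's totient function and $\omega(n)$ denotes the number of distinct prime divisors of $n$. $S_2$ denotes Schemmel's totient function: the multiplicative function on positive integers defined on prime powers ($k \geq 1$) by $S_2(2^k) = 0$ and $S_2(p^k) = p^{k-1}(p-2)$ for primes $p > 2$. A Deaconescu number is a positive composite integer $n \geq 4$ such that $S_2(n) \mid \phi(n) - 1$. *)

theory Defs
  imports "HOL-Number_Theory.Number_Theory"
begin

text \<open>
  Schemmel's totient function \<open>S\<^sub>2\<close> as a product over the prime powers \<open>p ^ k\<close> exactly dividing
  the argument. The lemmas below establish the properties that characterise it on positive
  integers: it is multiplicative, with the prescribed values at prime powers. The value at 0 is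
  irrelevant.
\<close>

definition schemmel2 :: "nat \<Rightarrow> nat" where
  "schemmel2 n =
     (\<Prod>p\<in>prime_factors n. if p = 2 then 0 else p ^ (multiplicity p n - 1) * (p - 2))"

text \<open>
  Here \<open>totient n \<ge> 1\<close>, so the subtraction on the naturals is not truncated. If \<open>n\<close> is even then
  \<open>schemmel2 n = 0\<close>, and divisibility by 0 means being equal to 0.
\<close>

definition deaconescu :: "nat \<Rightarrow> bool" where
  "deaconescu n \<longleftrightarrow> n \<ge> 4 \<and> \<not> prime n \<and> schemmel2 n dvd totient n - 1"

definition omega :: "nat \<Rightarrow> nat" where
  "omega n = card {p. prime p \<and> p dvd n}"

lemma schemmel2_1: "schemmel2 1 = 1"
  by (simp add: schemmel2_def)

lemma schemmel2_prime_power: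
  assumes "prime p" "k \<ge> 1"
  shows "schemmel2 (p ^ k) = (if p = 2 then 0 else p ^ (k - 1) * (p - 2))"
proof -
  have pf: "prime_factors (p ^ k) = {p}"
    using assms by (simp add: prime_factors_power prime_prime_factors)
  show ?thesis
    unfolding schemmel2_def pf using assms by simp
qed

lemma schemmel2_mult_coprime:
  assumes "m > 0" "n > 0" "coprime m n"
  shows "schemmel2 (m * n) = schemmel2 m * schemmel2 n"
proof -
  define f where "f = (\<lambda>(p::nat) (k::nat). if p = 2 then 0 else p ^ (k - 1) * (p - 2))"
  have S: "schemmel2 x = (\<Prod>p\<in>prime_factors x. f p (multiplicity p x))" for x
    by (simp add: schemmel2_def f_def)
  have not_both: "\<not> p dvd n" if "p dvd m" "prime p" for p
    using that assms(3) by (meson coprime_common_divisor not_prime_unit)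
  have mult: "multiplicity p (m * n) = multiplicity p m + multiplicity p n" if "prime p" for p
    using that assms by (intro prime_elem_multiplicity_mult_distrib) auto
  have un: "prime_factors (m * n) = prime_factors m \<union> prime_factors n"
    using assms by (intro prime_factors_product) auto
  have disj: "prime_factors m \<inter> prime_factors n = {}"
    using not_both by (auto simp: prime_factors_dvd)
  have m: "multiplicity p (m * n) = multiplicity p m" if "p \<in> prime_factors m" for p
    using that assms(1,2) mult[of p] not_both[of p] not_dvd_imp_multiplicity_0[of p n]
    by (simp add: prime_factors_dvd)
  have n: "multiplicity p (m * n) = multiplicity p n" if "p \<in> prime_factors n" for p
    using that assms(1,2) mult[of p] not_both[of p] not_dvd_imp_multiplicity_0[of p m]
    by (auto simp: prime_factors_dvd)
  show ?thesis
    unfolding S un using disj by (simp add: prod.union_disjoint m n cong: prod.cong)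
qed

end

theory Submission
  imports Defs
begin

text \<open>
  If \<open>n\<close> is a Deaconescu number, then \<open>S\<^sub>2(n)\<close> divides \<open>\<phi>(n) - 1\<close> and is therefore coprime to
  \<open>\<phi>(n)\<close>. This single fact forces \<open>n\<close> to be odd and squarefree, so that \<open>\<phi>(n)\<close> and \<open>S\<^sub>2(n)\<close> are
  the products of \<open>p - 1\<close> and of \<open>p - 2\<close> over the prime divisors \<open>p\<close> of \<open>n\<close>. Write
  \<open>\<phi>(n) = M * S\<^sub>2(n) + 1\<close>. The number \<open>M\<close> is odd because \<open>\<phi>(n)\<close> is even, and \<open>M \<noteq> 1\<close> because a
  composite \<open>n\<close> has at least two prime factors, for which the two products differ by more than 1.
  Hence the product of the ratios \<open>(p - 1) / (p - 2)\<close> exceeds \<open>M \<ge> 3\<close>.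

  Coprimality at the prime 3 shows that \<open>n\<close> cannot have both a prime factor \<open>1\<close> modulo 3 (which puts
  3 into \<open>\<phi>(n)\<close>) and one \<open>2\<close> modulo 3 (which puts 3 into \<open>S\<^sub>2(n)\<close>). All prime factors other than 3
  thus lie in one residue class modulo 6. The ratios over at most 16 members of such a class, starting
  no earlier than 5, multiply to less than \<open>5 / 2\<close>, which settles the case \<open>3 \<notin> P\<close>, \<open>P\<close> being the set
  of prime divisors. If \<open>3 \<in> P\<close>, the prime 3 contributes a further factor 2, but the remaining primes
  are then all \<open>1\<close> modulo 3. So 3 divides \<open>\<phi>(n)\<close> and does not divide \<open>M\<close>, which raises the lower
  bound to \<open>M \<ge> 5\<close>, and again the product is too small.
\<close>

section \<open>Products of ratios along an arithmetic progression\<close>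

text \<open>
  Listing \<open>I\<close> in increasing order, its \<open>k\<close>-th element is at least \<open>k\<close>; the induction peels off the
  largest element.
\<close>

lemma prod_antimono_le_prod_lessThan:
  fixes f :: "nat \<Rightarrow> 'a :: linordered_semidom"
  assumes "finite I" "antimono f" "\<And>i. f i \<ge> 0"
  shows "prod f I \<le> prod f {..<card I}"
  using assms(1)
proof (induction "card I" arbitrary: I)
  case 0
  then show ?case by simp
next
  case (Suc k)
  define m where "m = Max I"
  have I: "finite I" "I \<noteq> {}" using Suc by auto
  hence m: "m \<in> I" by (simp add: m_def)
  have card: "card (I - {m}) = k" using Suc m by simp
  have "I \<subseteq> {..m}" using I by (auto simp: m_def)
  hence "card I \<le> m + 1" using card_mono[of "{..m}" I] by simp
  hence "f m \<le> f k" using Suc.hyps(2) assms(2) by (auto simp: antimono_def)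
  moreover have "prod f (I - {m}) \<le> prod f {..<k}"
    using Suc.hyps(1)[of "I - {m}"] card I by simp
  ultimately have "f m * prod f (I - {m}) \<le> f k * prod f {..<k}"
    by (intro mult_mono assms(3) prod_nonneg) auto
  thus ?case
    using prod.remove[OF I(1) m, of f] by (simp flip: Suc.hyps(2) add: mult.commute)
qed

text \<open>
  The numbers in \<open>A\<close> are \<open>6 * i + 5\<close> or \<open>6 * i + 7\<close> for distinct \<open>i\<close>. In both cases the ratio is at
  most \<open>(6 * i + 4) / (6 * i + 3)\<close>, and the product of these fractions over \<open>i < 16\<close> is about
  \<open>2.08\<close>.
\<close>

lemma prod_ratio_residue_class_mod_6:
  fixes A :: "nat set"
  assumes fin: "finite A" and card: "card A \<le> 16"
    and ge: "\<And>p. p \<in> A \<Longrightarrow> p \<ge> 5"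
    and cls: "(\<forall>p\<in>A. p mod 6 = 1) \<or> (\<forall>p\<in>A. p mod 6 = 5)"
  shows "(\<Prod>p\<in>A. (real p - 1) / (real p - 2)) < 5 / 2"
proof -
  define f :: "nat \<Rightarrow> real" where "f = (\<lambda>i. (6 * real i + 4) / (6 * real i + 3))"
  define g :: "nat \<Rightarrow> nat" where "g = (\<lambda>p. (p - 5) div 6)"
  have f1: "f i \<ge> 1" for i by (simp add: f_def)
  hence f0: "f i \<ge> 0" for i by (meson order_trans zero_le_one)
  have mono: "antimono f"
    unfolding antimono_def f_def by (auto simp: field_simps)
  have shape: "p = 6 * g p + 7 \<and> p mod 6 = 1 \<or> p = 6 * g p + 5 \<and> p mod 6 = 5" if "p \<in> A" for p
  proof -
    have "p mod 6 = 1 \<or> p mod 6 = 5" using that cls by auto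
    thus ?thesis unfolding g_def using ge[OF that] by presburger
  qed
  have inj: "inj_on g A"
  proof (rule inj_onI)
    fix p q assume pq: "p \<in> A" "q \<in> A" "g p = g q"
    have "p mod 6 = q mod 6" using pq cls by auto
    thus "p = q" using shape[OF pq(1)] shape[OF pq(2)] pq(3) by auto
  qed
  have "(\<Prod>p\<in>A. (real p - 1) / (real p - 2)) \<le> (\<Prod>p\<in>A. f (g p))"
  proof (rule prod_mono)
    fix p assume p: "p \<in> A"
    have "(real p - 1) / (real p - 2) \<le> f (g p)"
    proof -
      from shape[OF p] consider "real p = 6 * real (g p) + 7" | "real p = 6 * real (g p) + 5"
        by (metis of_nat_add of_nat_mult of_nat_numeral)
      thus ?thesis by cases (auto simp: f_def field_simps)
    qed
    thus "0 \<le> (real p - 1) / (real p - 2) \<and> (real p - 1) / (real p - 2) \<le> f (g p)"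
      using ge[OF p] by simp
  qed
  also have "\<dots> = prod f (g ` A)"
    using inj by (simp add: prod.reindex)
  also have "\<dots> \<le> prod f {..<card A}"
    using prod_antimono_le_prod_lessThan[of "g ` A" f] fin mono f0 inj by (simp add: card_image)
  also have "\<dots> \<le> prod f {..<16}"
    using card f1 f0 by (intro prod_mono2) auto
  also have "\<dots> < 5 / 2"
    by (simp add: f_def lessThan_nat_numeral lessThan_Suc)
  finally show ?thesis .
qed

section \<open>Structure of Deaconescu numbers\<close>

lemma coprime_schemmel2_totient:
  assumes "deaconescu n"
  shows "coprime (schemmel2 n) (totient n)"
proof (rule coprimeI)
  fix d assume d: "d dvd schemmel2 n" "d dvd totient n"
  have "totient n > 0" using assms by (simp add: deaconescu_def)
  moreover have "d dvd totient n - 1"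
    using assms d(1) by (auto simp: deaconescu_def intro: dvd_trans)
  ultimately show "is_unit d"
    using d(2) by (metis Suc_diff_1 dvd_add_right_iff Suc_eq_plus1)
qed

text \<open>For even \<open>n\<close> the value \<open>S\<^sub>2(n)\<close> is 0, which is coprime to \<open>\<phi>(n)\<close> only if \<open>\<phi>(n) = 1\<close>.\<close>

lemma odd_deaconescu:
  assumes "deaconescu n"
  shows "odd n"
proof
  assume "even n"
  hence "2 \<in> prime_factors n"
    using assms by (auto simp: deaconescu_def prime_factors_dvd)
  hence "schemmel2 n = 0"
    unfolding schemmel2_def by (intro prod_zero) auto
  thus False
    using coprime_schemmel2_totient[OF assms] totient_gt_1[of n] assms
    by (simp add: deaconescu_def)
qed

text \<open>A square factor \<open>p\<^sup>2\<close> would put \<open>p\<close> into both \<open>S\<^sub>2(n)\<close> and \<open>\<phi>(n)\<close>.\<close>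

lemma multiplicity_deaconescu:
  assumes "deaconescu n" "p \<in> prime_factors n"
  shows "multiplicity p n = 1"
proof (rule ccontr)
  assume neq: "multiplicity p n \<noteq> 1"
  have n0: "n > 0" using assms(1) by (simp add: deaconescu_def)
  have p: "prime p" using assms(2) by auto
  have "multiplicity p n \<noteq> 0"
    using assms(2) by (metis count_prime_factorization not_in_iff p)
  hence m: "multiplicity p n - 1 \<noteq> 0" using neq by linarith
  have odd: "p \<noteq> 2"
    using odd_deaconescu[OF assms(1)] assms(2) by (auto simp: prime_factors_dvd)
  have pow: "p dvd p ^ (multiplicity p n - 1)" using m by (simp add: dvd_power)
  have "p dvd (if p = 2 then 0 else p ^ (multiplicity p n - 1) * (p - 2))"
    using pow by simp
  hence "p dvd schemmel2 n"
    unfolding schemmel2_def by (rule dvd_prodI[OF finite_set_mset assms(2), THEN dvd_trans[rotated]])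
  moreover have "p dvd p ^ (multiplicity p n - 1) * (p - 1)"
    using pow by simp
  hence "p dvd totient n"
    unfolding totient_formula1[OF n0] by (rule dvd_prodI[OF finite_set_mset assms(2), THEN dvd_trans[rotated]])
  ultimately show False
    using coprime_schemmel2_totient[OF assms(1)] p by (meson coprime_common_divisor not_prime_unit)
qed

lemma totient_deaconescu:
  assumes "deaconescu n"
  shows "totient n = (\<Prod>p\<in>prime_factors n. p - 1)"
proof -
  have "n > 0" using assms by (simp add: deaconescu_def)
  from totient_formula1[OF this] show ?thesis
    using multiplicity_deaconescu[OF assms] by (simp cong: prod.cong)
qed

lemma schemmel2_deaconescu:
  assumes "deaconescu n"
  shows "schemmel2 n = (\<Prod>p\<in>prime_factors n. p - 2)"
  unfolding schemmel2_def using multiplicity_deaconescu[OF assms] odd_deaconescu[OF assms]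
  by (intro prod.cong) (auto simp: prime_factors_dvd)

lemma card_prime_factors_deaconescu:
  assumes "deaconescu n"
  shows "card (prime_factors n) \<ge> 2"
proof (rule ccontr)
  assume "\<not> ?thesis"
  hence less: "card (prime_factors n) < 2" by simp
  have n: "n = \<Prod>(prime_factors n)"
  proof -
    have "n = (\<Prod>p\<in>prime_factors n. p ^ multiplicity p n)"
      using assms by (simp add: deaconescu_def prime_factorization_nat)
    also have "\<dots> = (\<Prod>p\<in>prime_factors n. p)"
      using multiplicity_deaconescu[OF assms] by (intro prod.cong) auto
    finally show ?thesis .
  qed
  from less consider "card (prime_factors n) = 0" | "card (prime_factors n) = 1" by linarith
  thus False
  proof cases
    case 1
    hence "prime_factors n = {}" by simp
    thus False using n assms by (simp add: deaconescu_def)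
  next
    case 2
    then obtain p where p: "prime_factors n = {p}" by (rule card_1_singletonE)
    hence "n = p" using n by simp
    moreover have "prime p" using p by auto
    ultimately show False using assms by (simp add: deaconescu_def)
  qed
qed

text \<open>
  If \<open>M = 1\<close>, split off one prime \<open>p\<close> and let \<open>a\<close> be the product of \<open>q - 1\<close> over the other primes.
  Then \<open>\<phi>(n) = (p - 2) * a + a \<ge> S\<^sub>2(n) + a\<close>, while \<open>a \<ge> 2\<close> since some other odd prime remains.
\<close>

lemma deaconescu_quotient:
  assumes "deaconescu n"
  obtains M where "totient n = M * schemmel2 n + 1" "odd M" "M \<ge> 3"
proof -
  define P where "P = prime_factors n"
  have finP: "finite P" by (simp add: P_def)
  have P3: "p \<ge> 3" if "p \<in> P" for p
  proof -
    have "prime p" "p dvd n" using that by (auto simp: P_def)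
    moreover from this have "p \<noteq> 2" using odd_deaconescu[OF assms] by auto
    ultimately show ?thesis using prime_ge_2_nat[of p] by linarith
  qed
  have pos: "totient n > 0" using assms by (simp add: deaconescu_def)
  obtain M where "totient n - 1 = schemmel2 n * M"
    using assms by (auto simp: deaconescu_def)
  hence M: "totient n = M * schemmel2 n + 1" using pos by (metis Suc_diff_1 Suc_eq_plus1 mult.commute)
  have "even (totient n)"
    using assms by (intro totient_even) (simp add: deaconescu_def)
  hence odd: "odd M" using M by auto
  have "M \<noteq> 1"
  proof
    assume "M = 1"
    obtain p q where pq: "p \<in> P" "q \<in> P" "p \<noteq> q"
      using card_prime_factors_deaconescu[OF assms]
      by (metis P_def card_2_iff' obtain_subset_with_card_n subset_iff)
    define a where "a = (\<Prod>r\<in>P - {p}. r - 1)"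
    have tot: "totient n = (p - 1) * a"
      unfolding totient_deaconescu[OF assms] a_def P_def[symmetric]
      by (rule prod.remove[OF finP pq(1)])
    have "schemmel2 n = (p - 2) * (\<Prod>r\<in>P - {p}. r - 2)"
      unfolding schemmel2_deaconescu[OF assms] P_def[symmetric]
      by (rule prod.remove[OF finP pq(1)])
    also have "\<dots> \<le> (p - 2) * a"
      unfolding a_def by (intro mult_left_mono prod_mono) auto
    finally have "schemmel2 n \<le> (p - 2) * a" .
    moreover have "p - 1 = (p - 2) + 1" using P3[OF pq(1)] by simp
    hence "(p - 1) * a = (p - 2) * a + a" by (simp only: distrib_right mult_1)
    ultimately have "totient n \<ge> schemmel2 n + a" using tot by simp
    moreover have "a \<ge> 2"
    proof -
      have "q - 1 dvd a"
        unfolding a_def using pq finP by (intro dvd_prodI) auto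
      moreover have "a > 0"
        unfolding a_def using P3 by (intro prod_pos) fastforce
      ultimately have "q - 1 \<le> a" by (rule dvd_imp_le)
      thus ?thesis using P3[OF pq(2)] by linarith
    qed
    ultimately show False using M \<open>M = 1\<close> by simp
  qed
  hence "M \<ge> 3" using odd by presburger
  with M odd show ?thesis by (rule that)
qed

text \<open>
  If some prime factor is 2 modulo 3, then 3 divides \<open>S\<^sub>2(n)\<close>, so no prime factor is 1 modulo 3. If
  moreover 3 were a prime factor, then \<open>\<phi>(n) \<equiv> 2\<close> modulo 3, since 3 contributes 2 and every other
  prime factor 1, contradicting \<open>3 dvd \<phi>(n) - 1\<close>.
\<close>

lemma prime_factors_mod_3_deaconescu:
  assumes "deaconescu n"
  shows "(\<forall>p\<in>prime_factors n. p mod 3 = 2) \<or> (\<forall>p\<in>prime_factors n - {3}. p mod 3 = 1)"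
proof (cases "\<exists>q\<in>prime_factors n. q mod 3 = 2")
  case True
  then obtain q where q: "q \<in> prime_factors n" "q mod 3 = 2" by blast
  have "3 dvd q - 2" using q(2) by presburger
  hence S: "3 dvd schemmel2 n"
    unfolding schemmel2_deaconescu[OF assms]
    by (rule dvd_prodI[OF finite_set_mset q(1), THEN dvd_trans[rotated]])
  hence T: "\<not> 3 dvd totient n"
    using coprime_schemmel2_totient[OF assms] coprime_common_divisor[of "schemmel2 n" "totient n" 3] by auto
  have not1: "p mod 3 \<noteq> 1" if "p \<in> prime_factors n" for p
  proof
    assume "p mod 3 = 1"
    hence "3 dvd p - 1" by presburger
    hence "3 dvd totient n"
      unfolding totient_deaconescu[OF assms]
      by (rule dvd_prodI[OF finite_set_mset that, THEN dvd_trans[rotated]])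
    with T show False ..
  qed
  have eq3: "p = 3" if "p \<in> prime_factors n" "p mod 3 = 0" for p
  proof -
    have "prime p" "3 dvd p" using that by auto
    thus ?thesis using primes_dvd_imp_eq[of 3 p] by simp
  qed
  have "3 \<notin> prime_factors n"
  proof
    assume 3: "3 \<in> prime_factors n"
    have "totient n = (3 - 1) * (\<Prod>p\<in>prime_factors n - {3}. p - 1)"
      unfolding totient_deaconescu[OF assms] by (rule prod.remove[OF finite_set_mset 3])
    moreover have "[(\<Prod>p\<in>prime_factors n - {3}. p - 1) = (\<Prod>p\<in>prime_factors n - {3}. 1)] (mod 3)"
    proof (rule cong_prod)
      fix p assume p: "p \<in> prime_factors n - {3}"
      hence mod: "p mod 3 \<noteq> 1" "p mod 3 \<noteq> 0" using not1[of p] eq3[of p] by auto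
      hence "p mod 3 = 2" by linarith
      then obtain k where "p = 3 * k + 2" by (metis mult_div_mod_eq)
      thus "[p - 1 = 1] (mod 3)" by (simp add: cong_def)
    qed
    ultimately have "totient n mod 3 = 2" by (simp add: cong_def) presburger
    moreover have "3 dvd totient n - 1"
      using S assms by (auto simp: deaconescu_def intro: dvd_trans)
    ultimately show False by presburger
  qed
  hence "p mod 3 = 2" if "p \<in> prime_factors n" for p
    using not1[OF that] eq3[OF that] that by fastforce
  thus ?thesis by blast
next
  case False
  have "p mod 3 = 1" if p: "p \<in> prime_factors n - {3}" for p
  proof -
    have "prime p" "p \<noteq> 3" using p by auto
    hence "p mod 3 \<noteq> 0" using primes_dvd_imp_eq[of 3 p] by (auto simp: mod_eq_0_iff_dvd)
    moreover have "p mod 3 \<noteq> 2" using False p by blast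
    ultimately show ?thesis by linarith
  qed
  thus ?thesis by blast
qed

section \<open>The lower bound for the number of prime divisors\<close>

theorem theorem1p2:
  fixes n :: nat
  assumes "deaconescu n"
  shows "omega n \<ge> 17"
proof (rule ccontr)
  assume "\<not> omega n \<ge> 17"
  define P where "P = prime_factors n"
  have n0: "n > 0" using assms by (simp add: deaconescu_def)
  have finP: "finite P" by (simp add: P_def)
  have "P = {p. prime p \<and> p dvd n}"
    using n0 by (auto simp: P_def prime_factors_dvd)
  hence card: "card P \<le> 16" using \<open>\<not> omega n \<ge> 17\<close> by (simp add: omega_def)
  have odd_P: "odd p" "p \<ge> 3" if "p \<in> P" for p
  proof -
    have p: "prime p" "p dvd n" using that by (auto simp: P_def)
    thus "odd p" using odd_deaconescu[OF assms] by (meson dvd_trans)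
    with prime_ge_2_nat[OF p(1)] show "p \<ge> 3" by (cases "p = 2") auto
  qed
  define h :: "nat \<Rightarrow> real" where "h = (\<lambda>p. (real p - 1) / (real p - 2))"
  obtain M where M: "totient n = M * schemmel2 n + 1" "odd M" "M \<ge> 3"
    using deaconescu_quotient[OF assms] .
  have large: "real M < prod h P"
  proof -
    have tot: "real (totient n) = (\<Prod>p\<in>P. real p - 1)"
      unfolding totient_deaconescu[OF assms] P_def[symmetric] of_nat_prod
      using odd_P(2) by (intro prod.cong) (fastforce simp: of_nat_diff)+
    have S: "real (schemmel2 n) = (\<Prod>p\<in>P. real p - 2)"
      unfolding schemmel2_deaconescu[OF assms] P_def[symmetric] of_nat_prod
      using odd_P(2) by (intro prod.cong) (fastforce simp: of_nat_diff)+
    have "real (schemmel2 n) > 0"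
      unfolding S using odd_P(2) by (intro prod_pos) fastforce
    moreover have "real (totient n) > real M * real (schemmel2 n)"
      using M(1) by simp
    moreover have "prod h P = real (totient n) / real (schemmel2 n)"
      unfolding h_def tot S by (rule prod_dividef)
    ultimately show ?thesis by (simp add: pos_less_divide_eq)
  qed
  have small: "prod h (P - {3}) < 5 / 2"
    unfolding h_def
  proof (rule prod_ratio_residue_class_mod_6)
    show "finite (P - {3})" using finP by simp
    show "card (P - {3}) \<le> 16" using card finP by (meson Diff_subset card_mono le_trans)
    show "p \<ge> 5" if "p \<in> P - {3}" for p
    proof -
      have "p \<ge> 3" "odd p" "p \<noteq> 3" using that odd_P by auto
      thus ?thesis by presburger
    qed
    \<comment> \<open>Oddness refines the residue classes modulo 3 to residue classes modulo 6.\<close>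
    have refine: "p mod 6 = 1" if "odd p" "p mod 3 = 1" for p :: nat
      using that by presburger
    have refine': "p mod 6 = 5" if "odd p" "p mod 3 = 2" for p :: nat
      using that by presburger
    show "(\<forall>p\<in>P - {3}. p mod 6 = 1) \<or> (\<forall>p\<in>P - {3}. p mod 6 = 5)"
      using prime_factors_mod_3_deaconescu[OF assms] refine refine' odd_P(1)
      unfolding P_def by (metis DiffD1)
  qed
  show False
  proof (cases "3 \<in> P")
    case False
    hence "prod h P < 5 / 2" using small by simp
    thus False using large M(3) by linarith
  next
    case True
    have "prod h P = h 3 * prod h (P - {3})" by (rule prod.remove[OF finP True])
    hence "prod h P < 5" using small by (simp add: h_def)
    hence "M < 5" using large by linarith
    hence "M = 3" using M(2,3) by presburger
    \<comment> \<open>A prime factor other than 3 is 1 modulo 3, so 3 divides \<open>\<phi>(n)\<close>; \<open>M = 3\<close> would make it divide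
      \<open>\<phi>(n) - 1\<close> too.\<close>
    have "card (P - {3}) > 0"
      using card_prime_factors_deaconescu[OF assms] True by (simp add: P_def)
    then obtain q where q: "q \<in> P" "q \<noteq> 3" by (force simp: card_gt_0_iff)
    have "\<not> (\<forall>p\<in>P. p mod 3 = 2)" using True by force
    hence "q mod 3 = 1"
      using prime_factors_mod_3_deaconescu[OF assms] q by (auto simp: P_def)
    hence "3 dvd q - 1" by presburger
    hence "3 dvd totient n"
      unfolding totient_deaconescu[OF assms] P_def[symmetric]
      by (rule dvd_prodI[OF finP q(1), THEN dvd_trans[rotated]])
    moreover have "totient n = 3 * schemmel2 n + 1" using M(1) \<open>M = 3\<close> by simp
    ultimately show False by presburger
  qed
qed

end
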